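(* For every $n\ge 1$, the number of connected components of the poset $(\mathcal{M}_n, \leq_{\mathcal{M}})$ is the Fibonacci number $F_{n+1}$, where $F_1=1$, $F_2=1$ and $F_{m+1}=F_m+F_{m-1}$ for $m\ge 2$.
   Context: A Motzkin path is a non-empty lattice path in $\mathbb{Z}^2$ starting at $(0,0)$, ending on the diagonal $y=x$, staying weakly above the diagonal, with steps $N=(0,1)$, $E=(1,0)$, $D=(1,1)$. The size of a path is its number of steps, and $\mathcal{M}_n$ is the set of Motzkin paths of size $n$. Order: a valley of a path $P$ is a lattice point $v$ on $P$ preceded by an $E$ step and followed by an $N$ or $D$ step. Given a valley $v$ of a Motzkin path $P$, let $w$ be the next lattice point on $P$ after $v$ with the same horizontal distance to the diagonal as $v$ (the horizontal distance of $(a,b)$ is $b-a$). Exchanging the sub-path of $P$ between $v$ and $w$ with the $E$ step just before $v$ gives a Motzkin path $Q$; one says $Q$ covers $P$. The order $\leq_{\mathcal{M}}$ on $\mathcal{M}_n$ is the reflexive transitive closure of this covering relation. Connected components of a poset are those of its Hasse diagram. *)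

theory Defs
  imports "HOL-Number_Theory.Fib"
begin

section \<open>Motzkin paths\<close>

datatype step = North | East | Diag

fun step_vec :: "step \<Rightarrow> int \<times> int" where
  "step_vec North = (0, 1)"
| "step_vec East = (1, 0)"
| "step_vec Diag = (1, 1)"

text \<open>A lattice path starting at the origin is given by its list of steps. Every step increases the
  sum of the coordinates, so the lattice points on the path are pairwise distinct and correspond
  to the indices from 0 to the length of the list.\<close>

definition lattice_point :: "step list \<Rightarrow> nat \<Rightarrow> int \<times> int" where
  "lattice_point P i =
     ((\<Sum>k<i. fst (step_vec (P ! k))), (\<Sum>k<i. snd (step_vec (P ! k))))"

definition horiz_dist :: "int \<times> int \<Rightarrow> int" where
  "horiz_dist v = snd v - fst v"

definition motzkin_path :: "step list \<Rightarrow> bool" where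
  "motzkin_path P \<longleftrightarrow>
     P \<noteq> [] \<and>
     fst (lattice_point P (length P)) = snd (lattice_point P (length P)) \<and>
     (\<forall>i\<le>length P. fst (lattice_point P i) \<le> snd (lattice_point P i))"

definition motzkin_paths :: "nat \<Rightarrow> step list set" where
  "motzkin_paths n = {P. motzkin_path P \<and> length P = n}"


section \<open>The order on Motzkin paths\<close>

text \<open>The lattice point with index \<open>i\<close> is a valley.\<close>

definition valley :: "step list \<Rightarrow> nat \<Rightarrow> bool" where
  "valley P i \<longleftrightarrow>
     0 < i \<and> i < length P \<and> P ! (i - 1) = East \<and> (P ! i = North \<or> P ! i = Diag)"

text \<open>The lattice point with index \<open>j\<close> is the first one after that with index \<open>i\<close> at the same
  horizontal distance to the diagonal.\<close>

definition next_same_dist :: "step list \<Rightarrow> nat \<Rightarrow> nat \<Rightarrow> bool" where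
  "next_same_dist P i j \<longleftrightarrow>
     i < j \<and> j \<le> length P \<and>
     horiz_dist (lattice_point P j) = horiz_dist (lattice_point P i) \<and>
     (\<forall>k. i < k \<and> k < j \<longrightarrow>
        horiz_dist (lattice_point P k) \<noteq> horiz_dist (lattice_point P i))"

definition motzkin_covers :: "step list \<Rightarrow> step list \<Rightarrow> bool" where
  "motzkin_covers P Q \<longleftrightarrow>
     motzkin_path P \<and>
     (\<exists>i j. valley P i \<and> next_same_dist P i j \<and>
        Q = take (i - 1) P @ take (j - i) (drop i P) @ [East] @ drop j P)"

text \<open>\<open>motzkin_covers\<close> preserves Motzkin paths and their length, so its closure may be taken on
  the whole type: on \<open>motzkin_paths n\<close> it is the closure within that set.\<close>

definition motzkin_le :: "step list \<Rightarrow> step list \<Rightarrow> bool" where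
  "motzkin_le = motzkin_covers\<^sup>*\<^sup>*"


section \<open>Connected components of a poset\<close>

definition hasse :: "'a set \<Rightarrow> ('a \<Rightarrow> 'a \<Rightarrow> bool) \<Rightarrow> ('a \<times> 'a) set" where
  "hasse A le =
     {(x, y). x \<in> A \<and> y \<in> A \<and> le x y \<and> x \<noteq> y \<and>
              (\<forall>z\<in>A. le x z \<and> le z y \<longrightarrow> z = x \<or> z = y)}"

definition poset_components :: "'a set \<Rightarrow> ('a \<Rightarrow> 'a \<Rightarrow> bool) \<Rightarrow> 'a set set" where
  "poset_components A le = A // (hasse A le \<union> (hasse A le)\<inverse>)\<^sup>*"

end

theory Submission imports Defs begin

text \<open>Deleting the East steps of a path leaves a word in the letters North and Diag, which no cover
  relation changes. Covers strictly increase the number of pairs of a non-East step followed later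
  by an East step, and a path without a valley has all its East steps at the end. So every path lies
  below the unique valley-free path with the same word, and the components correspond to the words
  in which North counts twice and Diag once, with total \<open>n\<close>.\<close>

section \<open>Height, word and inversion number of a path\<close>

definition height :: "step list \<Rightarrow> int" where
  "height P = int (count_list P North) - int (count_list P East)"

definition word :: "step list \<Rightarrow> step list" where
  "word P = filter (\<lambda>s. s \<noteq> East) P"

fun inversions :: "step list \<Rightarrow> nat" where
  "inversions [] = 0"
| "inversions (s # P) = (if s = East then 0 else count_list P East) + inversions P"

text \<open>Each North step of a Motzkin path is balanced by one East step, which the word omits, so
  a North letter accounts for two steps of the path.\<close>

definition words :: "nat \<Rightarrow> step list set" where
  "words n = {w. East \<notin> set w \<and> length w + count_list w North = n}"

lemma height_simps [simp]:
  "height [] = 0"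
  "height (s # P) = horiz_dist (step_vec s) + height P"
  "height (P @ Q) = height P + height Q"
  by (cases s; simp add: height_def horiz_dist_def)+

lemma horiz_dist_lattice_point:
  "i \<le> length P \<Longrightarrow> horiz_dist (lattice_point P i) = height (take i P)"
proof (induction i)
  case 0
  then show ?case by (simp add: lattice_point_def horiz_dist_def)
next
  case (Suc i)
  then show ?case
    by (simp add: take_Suc_conv_app_nth lattice_point_def horiz_dist_def)
qed

lemma motzkin_path_height:
  "motzkin_path P \<longleftrightarrow>
     P \<noteq> [] \<and> height P = 0 \<and> (\<forall>i\<le>length P. 0 \<le> height (take i P))"
proof -
  have *: "fst (lattice_point P i) \<le> snd (lattice_point P i) \<longleftrightarrow> 0 \<le> height (take i P)"
    "fst (lattice_point P i) = snd (lattice_point P i) \<longleftrightarrow> height (take i P) = 0"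
    if "i \<le> length P" for i
    using horiz_dist_lattice_point[OF that] by (auto simp: horiz_dist_def)
  show ?thesis
    using * unfolding motzkin_path_def by auto
qed

text \<open>Splittings instead of indices let the condition apply directly to
  concatenations.\<close>

lemma motzkin_path_prefix:
  "motzkin_path P \<longleftrightarrow>
     P \<noteq> [] \<and> height P = 0 \<and> (\<forall>xs ys. P = xs @ ys \<longrightarrow> 0 \<le> height xs)"
  unfolding motzkin_path_height
  by (metis append_eq_conv_conj append_take_drop_id le_add1 length_append)

section \<open>Effect of a cover on a path\<close>

lemma motzkin_coversE:
  assumes "motzkin_covers P Q"
  obtains X s B Y where "P = X @ East # s # B @ Y" "Q = X @ s # B @ East # Y"
    "s \<noteq> East" "height (s # B) = 0"
proof -
  from assms obtain i j where v: "valley P i" and n: "next_same_dist P i j"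
    and Q: "Q = take (i - 1) P @ take (j - i) (drop i P) @ [East] @ drop j P"
    unfolding motzkin_covers_def by blast
  have ij: "0 < i" "i < j" "j \<le> length P" and E: "P ! (i - 1) = East" "P ! i \<noteq> East"
    using v n by (auto simp: valley_def next_same_dist_def)
  define C where "C = take (j - i) (drop i P)"
  have dr: "drop i P = C @ drop j P"
    unfolding C_def using ij
    by (metis append_take_drop_id drop_drop le_add_diff_inverse2 less_imp_le_nat)
  have P: "P = take (i - 1) P @ East # C @ drop j P"
    using id_take_nth_drop[of "i - 1" P] ij E dr by simp
  have "take j P = take i P @ C"
    using ij unfolding C_def by (metis le_add_diff_inverse less_imp_le_nat take_add)
  moreover have "height (take j P) = height (take i P)"
    using n ij by (simp add: next_same_dist_def horiz_dist_lattice_point)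
  ultimately have hC: "height C = 0" by simp
  \<comment> \<open>At a valley the next step is not East. This step \<open>s\<close> is what later
    makes the inversion number grow strictly.\<close>
  have "C \<noteq> []" "hd C \<noteq> East"
    using ij E unfolding C_def by (auto simp: hd_drop_conv_nth)
  then obtain s B where C: "C = s # B" "s \<noteq> East"
    by (cases C) auto
  show ?thesis
    using that[of "take (i - 1) P" s B "drop j P"] P Q hC C unfolding C_def[symmetric] by simp
qed

lemma word_append [simp]: "word (P @ Q) = word P @ word Q"
  by (simp add: word_def)

lemma motzkin_covers_word: "motzkin_covers P Q \<Longrightarrow> word Q = word P"
  by (elim motzkin_coversE) (simp add: word_def)

text \<open>Delaying the East step raises the points of the block by one and leaves all other
  heights alone, so each prefix of \<open>Q\<close> is compared with a prefix of
  \<open>P\<close>.\<close>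

lemma motzkin_covers_motzkin_path:
  assumes "motzkin_covers P Q"
  shows "motzkin_path Q"
proof -
  from assms have "motzkin_path P" by (simp add: motzkin_covers_def)
  from assms obtain X s B Y where P: "P = X @ East # (s # B) @ Y"
    and Q: "Q = X @ (s # B) @ East # Y" and hB: "height (s # B) = 0"
    by (elim motzkin_coversE) auto
  define C where "C = s # B"
  note P = P[folded C_def] and Q = Q[folded C_def] and hB = hB[folded C_def]
  have pre: "0 \<le> height xs" if "P = xs @ ys" for xs ys
    using that \<open>motzkin_path P\<close> unfolding motzkin_path_prefix by blast
  have E: "horiz_dist (step_vec East) = - 1" by (simp add: horiz_dist_def)
  have "0 \<le> height xs" if split: "Q = xs @ ys" for xs ys
  proof -
    \<comment> \<open>The cut falls in \<open>X\<close>, in the block \<open>C\<close>, or after the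
      displaced East step. A cut just before that step is the second case with
      \<open>vs = []\<close>.\<close>
    consider zs where "X = xs @ zs" | us vs where "xs = X @ us" "C = us @ vs"
      | us vs where "xs = X @ C @ East # us" "Y = us @ vs"
    proof -
      from split have "xs @ ys = X @ C @ East # Y" using Q by simp
      then consider zs where "X = xs @ zs" | us where "xs = X @ us" "us @ ys = C @ East # Y"
        unfolding append_eq_append_conv2[of xs] by metis
      then show thesis
      proof cases
        case 2
        then consider vs where "C = us @ vs" | vs where "us = C @ vs" "vs @ ys = East # Y"
          unfolding append_eq_append_conv2[of us] by metis
        then show thesis
        proof cases
          case 1
          then show thesis using 2 that(2) by blast
        next
          case (2 vs)
          then show thesis
            using \<open>xs = X @ us\<close> that(2)[of C "[]"] that(3) by (cases vs) auto
        qed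
      qed (rule that(1))
    qed
    then show ?thesis
    proof cases
      case 1
      then show ?thesis using pre[of xs] P by simp
    next
      case 2
      then show ?thesis using pre[of "X @ East # us" "vs @ Y"] P E by simp
    next
      case 3
      then show ?thesis using pre[of "X @ East # C @ us" vs] P E by simp
    qed
  qed
  moreover have "height Q = 0"
    using \<open>motzkin_path P\<close> unfolding motzkin_path_prefix P Q by simp
  ultimately show ?thesis
    unfolding motzkin_path_prefix using Q by auto
qed

lemma motzkin_covers_length: "motzkin_covers P Q \<Longrightarrow> length Q = length P"
  by (elim motzkin_coversE) simp

text \<open>The last summand counts the pairs that straddle the cut.\<close>

lemma inversions_append:
  "inversions (xs @ ys) = inversions xs + inversions ys + length (word xs) * count_list ys East"
  by (induction xs) (auto simp: word_def)

text \<open>Moving an East step behind \<open>s # B\<close> loses no pair and gains one for each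
  non-East step of the block, among them \<open>s\<close>.\<close>

lemma motzkin_covers_inversions: "motzkin_covers P Q \<Longrightarrow> inversions P < inversions Q"
  by (elim motzkin_coversE) (simp add: inversions_append word_def algebra_simps)

lemma motzkin_le_word: "motzkin_le P Q \<Longrightarrow> word P = word Q"
  unfolding motzkin_le_def by (induction rule: rtranclp_induct) (auto dest: motzkin_covers_word)

lemma motzkin_le_inversions:
  assumes "motzkin_le P Q" "P \<noteq> Q"
  shows "inversions P < inversions Q"
proof -
  have "motzkin_covers\<^sup>+\<^sup>+ P Q"
    using assms unfolding motzkin_le_def by (metis rtranclpD)
  then show ?thesis
    by (induction rule: tranclp_induct) (auto dest: motzkin_covers_inversions intro: less_trans)
qed

section \<open>Valleys and the climb to a valley-free path\<close>

lemma valley_imp_motzkin_covers: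
  assumes "motzkin_path P" "valley P i"
  shows "\<exists>Q. motzkin_covers P Q"
proof -
  have i: "i < length P" "P ! i \<noteq> East"
    using assms(2) by (auto simp: valley_def)
  let ?h = "\<lambda>k. height (take k P)"
  have step: "?h (Suc k) = ?h k + horiz_dist (step_vec (P ! k))" if "k < length P" for k
    using that by (simp add: take_Suc_conv_app_nth)
  have vec: "horiz_dist (step_vec s) \<ge> (if s = East then - 1 else 0)" for s
    by (cases s) (auto simp: horiz_dist_def)
  \<comment> \<open>With "at most" in place of equality the end of the path, at height 0, is a
    witness at once.\<close>
  define R where "R k \<longleftrightarrow> i < k \<and> k \<le> length P \<and> ?h k \<le> ?h i" for k
  have "R (length P)"
    using assms(1) i by (auto simp: R_def motzkin_path_height)
  define j where "j = (LEAST k. R k)"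
  have j: "R j" "\<And>k. k < j \<Longrightarrow> \<not> R k"
    unfolding j_def using LeastI[of R, OF \<open>R (length P)\<close>] not_less_Least by auto
  then obtain m where m: "j = Suc m" "i \<le> m" "m < length P"
    by (cases j) (auto simp: R_def)
  \<comment> \<open>A step lowers the height by at most one, so the first point at or below the
    level of \<open>i\<close> cannot skip that level. If it comes directly after \<open>i\<close>,
    the step there is not East and lowers nothing.\<close>
  have "?h i \<le> ?h j"
  proof (cases "m = i")
    case True
    then show ?thesis using step[of m] vec[of "P ! m"] i m by simp
  next
    case False
    then have "?h i < ?h m" using j(2)[of m] m by (auto simp: R_def)
    then show ?thesis using step[of m] vec[of "P ! m"] m by (auto split: if_splits)
  qed
  then have "next_same_dist P i j"
    using j i unfolding next_same_dist_def R_def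
    by (force simp: horiz_dist_lattice_point)
  then show ?thesis
    using assms unfolding motzkin_covers_def by blast
qed

lemma no_valley_sorted:
  assumes "\<And>i. \<not> valley P i"
  shows "P = word P @ replicate (count_list P East) East"
  using assms
proof (induction P)
  case Nil
  then show ?case by (simp add: word_def)
next
  case (Cons s P)
  have "\<not> valley P i" for i
    using Cons.prems[of "Suc i"] by (auto simp: valley_def nth_Cons')
  then have IH: "P = word P @ replicate (count_list P East) East"
    by (rule Cons.IH)
  show ?case
  proof (cases "s = East")
    case True
    \<comment> \<open>By the induction hypothesis a nonempty word would put its first letter right
      after the leading East step, creating a valley at index 1.\<close>
    have "word P = []"
    proof (rule ccontr)
      assume "word P \<noteq> []"
      then obtain t w where w: "word P = t # w" by (cases "word P") auto
      then have "t \<in> set (word P)" by simp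
      then have "t \<noteq> East" by (auto simp: word_def)
      moreover have "P ! 0 = t" "P \<noteq> []" using IH w by (metis nth_Cons_0 append_Cons, auto)
      ultimately show False
        using Cons.prems[of 1] True by (cases t) (auto simp: valley_def)
    qed
    then show ?thesis using True IH by (simp add: word_def)
  next
    case False
    then show ?thesis using IH by (simp add: word_def)
  qed
qed

lemma count_list_word: "count_list (word P) North = count_list P North"
  by (induction P) (auto simp: word_def)

lemma length_word: "length P = length (word P) + count_list P East"
  by (induction P) (auto simp: word_def)

text \<open>The number of East steps is forced by the return to the diagonal.\<close>

definition top_path :: "step list \<Rightarrow> step list" where
  "top_path w = w @ replicate (count_list w North) East"

text \<open>While there is a valley, pass to a cover. Length and word stay fixed and the inversion
  number grows, so the climb stops at a path without valleys.\<close>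

lemma motzkin_le_top_path:
  assumes "motzkin_path P"
  shows "motzkin_le P (top_path (word P))"
  using assms
proof (induction "length P * length P - inversions P" arbitrary: P rule: less_induct)
  case less
  show ?case
  proof (cases "\<exists>i. valley P i")
    case True
    then obtain Q where Q: "motzkin_covers P Q"
      using valley_imp_motzkin_covers less.prems by blast
    \<comment> \<open>This crude bound ensures that the truncated difference really
      decreases.\<close>
    have "inversions Q \<le> length Q * length Q"
    proof (induction Q)
      case (Cons s Q)
      then show ?case using count_le_length[of Q East] by auto
    qed simp
    then have "length Q * length Q - inversions Q < length P * length P - inversions P"
      using motzkin_covers_inversions[OF Q] motzkin_covers_length[OF Q] by simp
    then have "motzkin_le Q (top_path (word Q))"
      using less.hyps motzkin_covers_motzkin_path[OF Q] by blast
    then show ?thesis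
      using Q motzkin_covers_word[OF Q] unfolding motzkin_le_def
      by (metis converse_rtranclp_into_rtranclp)
  next
    case False
    then have "P = word P @ replicate (count_list P East) East"
      using no_valley_sorted by blast
    moreover have "count_list P East = count_list (word P) North"
      using less.prems by (simp add: motzkin_path_height height_def count_list_word)
    ultimately have "P = top_path (word P)" by (simp add: top_path_def)
    then show ?thesis by (simp add: motzkin_le_def)
  qed
qed

section \<open>Words as an index set and their number\<close>

lemma count_list_replicate [simp]:
  "count_list (replicate k x) y = (if x = y then k else 0)"
  by (induction k) auto

lemma word_top_path: "East \<notin> set w \<Longrightarrow> word (top_path w) = w"
  by (auto simp: top_path_def word_def filter_id_conv)

text \<open>The height never falls along \<open>w\<close>, and the final East steps undo the North
  steps one by one.\<close>

lemma top_path_mem: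
  assumes "w \<in> words n" "n \<ge> 1"
  shows "top_path w \<in> motzkin_paths n"
proof -
  have w: "East \<notin> set w" "length w + count_list w North = n"
    using assms by (auto simp: words_def)
  have "count_list (take i w) East = 0" for i
    using w(1) by (meson count_notin in_set_takeD)
  then have "0 \<le> height (take i (top_path w))" for i
    by (cases "i \<le> length w") (use w(1) in \<open>auto simp: top_path_def height_def\<close>)
  moreover have "height (top_path w) = 0"
    using w by (simp add: top_path_def height_def)
  moreover have "length (top_path w) = n"
    using w by (simp add: top_path_def)
  ultimately show ?thesis
    using assms(2) by (auto simp: motzkin_paths_def motzkin_path_height)
qed

lemma word_mem:
  assumes "P \<in> motzkin_paths n"
  shows "word P \<in> words n"
proof -
  have "East \<notin> set (word P)" by (simp add: word_def)
  moreover have "count_list P East = count_list P North"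
    using assms by (simp add: motzkin_paths_def motzkin_path_height height_def)
  ultimately show ?thesis
    using assms length_word[of P] by (simp add: words_def motzkin_paths_def count_list_word)
qed

lemma word_image: "n \<ge> 1 \<Longrightarrow> word ` motzkin_paths n = words n"
  using word_mem top_path_mem word_top_path
  by (force simp: words_def image_iff)

lemma finite_words: "finite (words n)"
proof (rule finite_subset)
  show "words n \<subseteq> {w. set w \<subseteq> {North, East, Diag} \<and> length w \<le> n}"
    by (auto simp: words_def) (metis step.exhaust)
qed (rule finite_lists_length_le, simp)

text \<open>Removing a first letter North lowers the total by two, removing Diag by one: this is the
  Fibonacci recurrence.\<close>

lemma words_Suc_Suc: "words (Suc (Suc n)) = (#) North ` words n \<union> (#) Diag ` words (Suc n)"
proof (intro equalityI subsetI)
  fix w assume "w \<in> words (Suc (Suc n))"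
  then show "w \<in> (#) North ` words n \<union> (#) Diag ` words (Suc n)"
  proof (cases w)
    case (Cons s v)
    with \<open>w \<in> words _\<close> show ?thesis by (cases s) (auto simp: words_def)
  qed (simp add: words_def)
qed (auto simp: words_def)

lemma card_words: "card (words n) = fib (Suc n)"
proof (induction n rule: fib.induct)
  case 1
  have "words 0 = {[]}" by (auto simp: words_def)
  then show ?case by simp
next
  case 2
  have "w \<in> words (Suc 0) \<longleftrightarrow> w = [Diag]" for w
  proof (cases w)
    case (Cons s v)
    then show ?thesis by (cases s) (auto simp: words_def)
  qed (simp add: words_def)
  then have "words (Suc 0) = {[Diag]}" by auto
  then show ?case by simp
next
  case (3 n)
  have "card (words (Suc (Suc n))) = card ((#) North ` words n) + card ((#) Diag ` words (Suc n))"
    unfolding words_Suc_Suc by (intro card_Un_disjoint) (auto simp: finite_words)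
  then show ?case using 3 by (simp add: card_image)
qed

section \<open>Connected components of the Hasse diagram\<close>

lemma le_imp_hasse_rtrancl:
  fixes f :: "'a \<Rightarrow> nat"
  assumes mono: "\<And>x y. le x y \<Longrightarrow> x \<noteq> y \<Longrightarrow> f x < f y"
    and "x \<in> A" "y \<in> A" "le x y"
  shows "(x, y) \<in> (hasse A le)\<^sup>*"
  using assms(2-)
proof (induction "f y - f x" arbitrary: x y rule: less_induct)
  case less
  show ?case
  proof (cases "x = y \<or> (x, y) \<in> hasse A le")
    case False
    \<comment> \<open>A comparable pair that is not an edge has an element strictly between. It
      splits the gap in \<open>f\<close> into two smaller gaps, so the induction applies to both
      halves.\<close>
    then obtain z where z: "z \<in> A" "le x z" "le z y" "z \<noteq> x" "z \<noteq> y"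
      using less.prems by (auto simp: hasse_def)
    have "f x < f z" "f z < f y" using mono z by metis+
    then have "(x, z) \<in> (hasse A le)\<^sup>*" "(z, y) \<in> (hasse A le)\<^sup>*"
      using less.hyps[of z x] less.hyps[of y z] less.prems z by auto
    then show ?thesis by (rule rtrancl_trans)
  qed auto
qed

text \<open>Edges keep the word, and two paths with the same word both climb to the same top
  path.\<close>

lemma component_iff_word:
  assumes "P \<in> motzkin_paths n"
  defines "H \<equiv> hasse (motzkin_paths n) motzkin_le"
  shows "(P, Q) \<in> (H \<union> H\<inverse>)\<^sup>* \<longleftrightarrow> Q \<in> motzkin_paths n \<and> word Q = word P"
proof
  assume "(P, Q) \<in> (H \<union> H\<inverse>)\<^sup>*"
  then show "Q \<in> motzkin_paths n \<and> word Q = word P"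
    by (induction rule: rtrancl_induct)
      (use assms in \<open>auto simp: hasse_def dest: motzkin_le_word\<close>)
next
  have top: "(R, top_path (word R)) \<in> H\<^sup>*" if "R \<in> motzkin_paths n" for R
  proof -
    have "R \<noteq> []" "length R = n" using that by (auto simp: motzkin_paths_def motzkin_path_def)
    then have "n \<ge> 1" by (cases R) auto
    then show ?thesis
      unfolding H_def using that
      by (intro le_imp_hasse_rtrancl[where f = inversions] motzkin_le_inversions
          motzkin_le_top_path top_path_mem word_mem) (auto simp: motzkin_paths_def)
  qed
  assume Q: "Q \<in> motzkin_paths n \<and> word Q = word P"
  have "(P, top_path (word P)) \<in> (H \<union> H\<inverse>)\<^sup>*"
    using top[OF assms(1)] rtrancl_mono[of H "H \<union> H\<inverse>"] by blast
  moreover have "(top_path (word P), Q) \<in> (H\<inverse>)\<^sup>*"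
    using top[of Q] Q by (simp add: rtrancl_converse)
  then have "(top_path (word P), Q) \<in> (H \<union> H\<inverse>)\<^sup>*"
    using rtrancl_mono[of "H\<inverse>" "H \<union> H\<inverse>"] by blast
  ultimately show "(P, Q) \<in> (H \<union> H\<inverse>)\<^sup>*" by (rule rtrancl_trans)
qed

theorem proposition4p1:
  fixes n :: nat
  assumes "n \<ge> 1"
  shows "card (poset_components (motzkin_paths n) motzkin_le) = fib (n + 1)"
proof -
  \<comment> \<open>The components are the fibres of \<open>word\<close>.\<close>
  define F where "F w = {Q \<in> motzkin_paths n. word Q = w}" for w
  have "poset_components (motzkin_paths n) motzkin_le = (\<lambda>P. F (word P)) ` motzkin_paths n"
    unfolding poset_components_def quotient_def F_def
    by (auto simp: component_iff_word Image_singleton)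
  also have "\<dots> = F ` words n"
    using word_image[OF assms] by (metis image_image)
  finally have "poset_components (motzkin_paths n) motzkin_le = F ` words n" .
  moreover have "inj_on F (words n)"
  proof (rule inj_onI)
    fix v w assume v: "v \<in> words n" and "F v = F w"
    \<comment> \<open>Each fibre contains the top path of its word, from which the word can be read
      off, so distinct words have distinct fibres.\<close>
    then have "top_path v \<in> F w"
      using top_path_mem[OF v assms] by (auto simp: F_def words_def word_top_path)
    then show "v = w"
      using v by (simp add: F_def words_def word_top_path)
  qed
  ultimately show ?thesis
    by (simp add: card_image card_words)
qed

end
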